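(* SimplE$^+$ guarantees subsumption using an inequality constraint. That is, let $k\ge1$ and let $\mathbf r=[\mathbf r^+,\mathbf r^-]$ and $\mathbf s=[\mathbf s^+,\mathbf s^-]$ be relation embeddings with $\mathbf r^\pm,\mathbf s^\pm\in\mathbb R^k$ satisfying the element-wise inequality $\mathbf s\ge\mathbf r$ (i.e. $\mathbf s^+\ge\mathbf r^+$ and $\mathbf s^-\ge\mathbf r^-$ element-wise). Then $\mu(\mathbf h,\mathbf s,\mathbf t)\ge\mu(\mathbf h,\mathbf r,\mathbf t)$ for all legal SimplE$^+$ entity embeddings $\mathbf h,\mathbf t$, i.e. the subsumption $(h,r,t)\rightarrow(h,s,t)$ is enforced for all possible entities $h,t$.
   Context: For vectors $\mathbf x,\mathbf y,\mathbf z\in\mathbb R^k$, write $\langle \mathbf x,\mathbf y,\mathbf z\rangle=\sum_{\ell=1}^k x_\ell y_\ell z_\ell$. In the SimplE model with embedding vectors of size $k$, each entity $e$ has an embedding $\mathbf e=[\mathbf e^+,\mathbf e^-]$, where $\mathbf e^+\in\mathbb R^k$ is its embedding as a head and $\mathbf e^-\in\mathbb R^k$ its embedding as a tail, and each relation $r$ has an embedding $\mathbf r=[\mathbf r^+,\mathbf r^-]$, where $\mathbf r^+\in\mathbb R^k$ is the forward embedding and $\mathbf r^-\in\mathbb R^k$ the embedding of its inverse. The probability assigned to a triple (head $h$, relation $r$, tail $t$) is $$\mu(\mathbf h,\mathbf r,\mathbf t)=\sigma\left(\tfrac12\left(\langle\mathbf h^+,\mathbf r^+,\mathbf t^-\rangle+\langle\mathbf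 t^+,\mathbf r^-,\mathbf h^-\rangle\right)\right),\qquad \sigma(x)=\frac1{1+e^{-x}}.$$ SimplE$^+$ is SimplE with the restriction that the legal entity embeddings are exactly those that are element-wise non-negative: $\mathbf e^+\ge0$ and $\mathbf e^-\ge 0$ (relation embeddings are unrestricted). A model enforces the subsumption $(h,r,t)\rightarrow(h,s,t)$ (relation $r$ is a subproperty of relation $s$) over all possible entities if $\mu(\mathbf h,\mathbf r,\mathbf t)\le\mu(\mathbf h,\mathbf s,\mathbf t)$ for all legal entity embeddings $\mathbf h,\mathbf t$. *)

theory Defs
  imports "HOL-Analysis.Analysis"
begin

text \<open>The embedding size \<open>k\<close> is \<open>CARD('k)\<close>, hence at least 1.\<close>

datatype ('k::finite) entity_embedding =
  Entity (ent_head: "real ^ 'k") (ent_tail: "real ^ 'k")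

datatype ('k::finite) relation_embedding =
  Relation (rel_fwd: "real ^ 'k") (rel_inv: "real ^ 'k")

definition triple_prod :: "real ^ 'k \<Rightarrow> real ^ 'k \<Rightarrow> real ^ 'k \<Rightarrow> real" where
  "triple_prod x y z = (\<Sum>l\<in>UNIV. x $ l * y $ l * z $ l)"

definition sigmoid :: "real \<Rightarrow> real" where
  "sigmoid x = 1 / (1 + exp (- x))"

definition simple_prob ::
  "'k::finite entity_embedding \<Rightarrow> 'k relation_embedding \<Rightarrow> 'k entity_embedding \<Rightarrow> real" where
  "simple_prob h r t =
     sigmoid (1 / 2 * (triple_prod (ent_head h) (rel_fwd r) (ent_tail t)
                     + triple_prod (ent_head t) (rel_inv r) (ent_tail h)))"

text \<open>The order on \<^typ>\<open>real ^ 'k\<close> is the element-wise one (\<open>less_eq_vec_def\<close>).\<close>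

definition simple_plus_entities :: "'k::finite entity_embedding set" where
  "simple_plus_entities = {e. 0 \<le> ent_head e \<and> 0 \<le> ent_tail e}"

text \<open>A model variant is determined by its set of legal entity embeddings.\<close>

definition enforces_subsumption ::
  "'k::finite entity_embedding set \<Rightarrow> 'k relation_embedding \<Rightarrow> 'k relation_embedding \<Rightarrow> bool" where
  "enforces_subsumption legal r s \<longleftrightarrow>
     (\<forall>h\<in>legal. \<forall>t\<in>legal. simple_prob h r t \<le> simple_prob h s t)"

end

theory Submission
  imports Defs
begin

text \<open>The score inside \<open>sigmoid\<close> is linear in the relation embedding, and its
  coefficients are products of one head entry and one tail entry. For legal entities these are
  nonnegative, so raising the relation entries cannot lower the score
  (\<open>triple_prod_mono_middle\<close>); \<open>mono_sigmoid\<close> carries this over to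
  probabilities.\<close>

lemma mono_sigmoid: "mono sigmoid"
  by (rule monoI) (simp add: sigmoid_def frac_le add_pos_pos)

text \<open>Termwise: factors \<open>x $ l\<close> and \<open>z $ l\<close> are nonnegative, so they
  preserve order whatever the signs of \<open>y\<close> and \<open>y'\<close>.\<close>

lemma triple_prod_mono_middle:
  fixes x y y' z :: "real ^ 'k::finite"
  assumes "0 \<le> x" "0 \<le> z" "y \<le> y'"
  shows "triple_prod x y z \<le> triple_prod x y' z"
  using assms unfolding triple_prod_def less_eq_vec_def
  by (intro sum_mono mult_right_mono mult_left_mono) auto

theorem theorem5:
  fixes r s :: "'k::finite relation_embedding"
  assumes "rel_fwd s \<ge> rel_fwd r"
    and "rel_inv s \<ge> rel_inv r"
  shows "enforces_subsumption simple_plus_entities r s"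
  unfolding enforces_subsumption_def
proof (intro ballI)
  fix h t :: "'k entity_embedding"
  assume "h \<in> simple_plus_entities" "t \<in> simple_plus_entities"
  then have "triple_prod (ent_head h) (rel_fwd r) (ent_tail t)
      \<le> triple_prod (ent_head h) (rel_fwd s) (ent_tail t)"
    and "triple_prod (ent_head t) (rel_inv r) (ent_tail h)
      \<le> triple_prod (ent_head t) (rel_inv s) (ent_tail h)"
    \<comment> \<open>The two products swap the roles of \<open>h\<close> and \<open>t\<close>, so
      together they use nonnegativity of both halves of both entities.\<close>
    using assms by (simp_all add: simple_plus_entities_def triple_prod_mono_middle)
  then show "simple_prob h r t \<le> simple_prob h s t"
    unfolding simple_prob_def by (intro monoD[OF mono_sigmoid]) simp
qed

end
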